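(* Let $E$ be a finite set and $\mathcal{F}\subseteq 2^E$. Then $(E,\mathcal{F})$ is an antimatroid if and only if there exists an isotone operator $\Psi:2^E\to2^E$ (with $\Psi(X)\subseteq E\setminus X$ for all $X\subseteq E$) such that $\mathcal{F}=\mathcal{F}(\Psi)$.
   Context: A set system $(E,\mathcal{F})$ with $\mathcal{F}\neq\emptyset$ is an antimatroid if (A1) for each nonempty $X\in\mathcal{F}$ there is $x\in X$ with $X\setminus\{x\}\in\mathcal{F}$, and (A2) for all $X,Y\in\mathcal{F}$ with $X\not\subseteq Y$ there is $x\in X\setminus Y$ with $Y\cup\{x\}\in\mathcal{F}$. An operator $\Psi:2^E\to2^E$ with $\Psi(X)\subseteq E\setminus X$ for all $X$ is isotone if for all $X\subseteq Y\subseteq E$, $\Psi(X)\cap(E\setminus Y)\subseteq\Psi(Y)$. The family $\mathcal{F}(\Psi)$ consists of all $X\subseteq E$ for which there exist $x_1,\dots,x_m$ ($m\ge0$) with $X=\{x_1,\dots,x_m\}$ and $x_i\in\Psi(\{x_1,\dots,x_{i-1}\})$ for $1\le i\le m$. *)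

theory Defs
  imports Main
begin

definition antimatroid :: "'a set \<Rightarrow> 'a set set \<Rightarrow> bool" where
  "antimatroid E F \<longleftrightarrow>
     F \<subseteq> Pow E \<and> F \<noteq> {} \<and>
     (\<forall>X\<in>F. X \<noteq> {} \<longrightarrow> (\<exists>x\<in>X. X - {x} \<in> F)) \<and>
     (\<forall>X\<in>F. \<forall>Y\<in>F. \<not> X \<subseteq> Y \<longrightarrow> (\<exists>x\<in>X - Y. Y \<union> {x} \<in> F))"

text \<open>An operator on the subsets of \<open>E\<close> is a total HOL function on \<open>'a set\<close>; all
  notions below depend only on its values on subsets of \<open>E\<close>.\<close>

definition expansion_operator :: "'a set \<Rightarrow> ('a set \<Rightarrow> 'a set) \<Rightarrow> bool" where
  "expansion_operator E \<Psi> \<longleftrightarrow> (\<forall>X. X \<subseteq> E \<longrightarrow> \<Psi> X \<subseteq> E - X)"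

definition isotone_operator :: "'a set \<Rightarrow> ('a set \<Rightarrow> 'a set) \<Rightarrow> bool" where
  "isotone_operator E \<Psi> \<longleftrightarrow>
     (\<forall>X Y. X \<subseteq> Y \<and> Y \<subseteq> E \<longrightarrow> \<Psi> X \<inter> (E - Y) \<subseteq> \<Psi> Y)"

text \<open>The list \<open>xs\<close> is \<open>x\<^sub>1, \<dots>, x\<^sub>m\<close>, indexed from 0, so \<open>set (take i xs)\<close> is the set of
  the elements preceding \<open>xs ! i\<close>.\<close>

definition generated_family :: "'a set \<Rightarrow> ('a set \<Rightarrow> 'a set) \<Rightarrow> 'a set set" where
  "generated_family E \<Psi> =
     {X. X \<subseteq> E \<and> (\<exists>xs. X = set xs \<and> (\<forall>i<length xs. xs ! i \<in> \<Psi> (set (take i xs))))}"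

end

theory Submission
  imports Defs
begin

text \<open>An antimatroid is generated by the operator sending \<open>X\<close> to all \<open>x \<in> E - X\<close> that can be
  added to some feasible subset of \<open>X\<close>: by (A1) every feasible set is generated, and if \<open>Y\<close> is
  feasible and \<open>x\<close> can be added to a feasible \<open>Z \<subseteq> Y\<close>, then (A2) applied to \<open>Z \<union> {x}\<close> and \<open>Y\<close>
  can only add \<open>x\<close>. Conversely, given feasible \<open>X\<close>, \<open>Y\<close> with \<open>X\<close> not contained in \<open>Y\<close>, the first
  element outside \<open>Y\<close> in a generating sequence of \<open>X\<close> can be added to \<open>Y\<close> by isotonicity.\<close>

lemma generated_family_subset: "X \<in> generated_family E \<Psi> \<Longrightarrow> X \<subseteq> E"
  by (simp add: generated_family_def)

lemma generated_family_empty: "{} \<in> generated_family E \<Psi>"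
  by (auto simp: generated_family_def)

lemma generated_family_insert:
  assumes "X \<in> generated_family E \<Psi>" and "x \<in> \<Psi> X" and "x \<in> E"
  shows "insert x X \<in> generated_family E \<Psi>"
proof -
  obtain xs where xs: "X \<subseteq> E" "X = set xs" "\<forall>i<length xs. xs ! i \<in> \<Psi> (set (take i xs))"
    using assms(1) by (auto simp: generated_family_def)
  have "insert x X = set (xs @ [x])"
    using xs(2) by simp
  moreover have "\<forall>i<length (xs @ [x]). (xs @ [x]) ! i \<in> \<Psi> (set (take i (xs @ [x])))"
    using xs(2,3) assms(2) by (auto simp: nth_append less_Suc_eq)
  moreover have "insert x X \<subseteq> E"
    using xs(1) assms(3) by simp
  ultimately show ?thesis
    unfolding generated_family_def by blast
qed

text \<open>Every prefix of a generating sequence is itself generating, so the sequence can be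
  peeled off from its last element. With this rule later arguments speak of sets only and never of
  sequences or indices.\<close>

lemma generated_family_induct [consumes 1, case_names empty insert]:
  assumes "X \<in> generated_family E \<Psi>"
    and "P {}"
    and "\<And>X x. X \<in> generated_family E \<Psi> \<Longrightarrow> P X \<Longrightarrow> x \<in> \<Psi> X \<Longrightarrow> x \<in> E \<Longrightarrow> P (insert x X)"
  shows "P X"
proof -
  obtain xs where xs: "X = set xs" "set xs \<subseteq> E" "\<forall>i<length xs. xs ! i \<in> \<Psi> (set (take i xs))"
    using assms(1) by (auto simp: generated_family_def)
  have "P (set xs)"
    using xs(2,3)
  proof (induction xs rule: rev_induct)
    case Nil
    then show ?case using assms(2) by simp
  next
    case (snoc x xs)
    have prefix: "xs ! i \<in> \<Psi> (set (take i xs))" if "i < length xs" for i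
      using snoc.prems(2)[rule_format, of i] that by (simp add: nth_append)
    have "set xs \<in> generated_family E \<Psi>"
      using prefix snoc.prems(1) by (auto simp: generated_family_def)
    moreover have "P (set xs)"
      using snoc.IH prefix snoc.prems(1) by simp
    \<comment> \<open>At index \<open>length xs\<close> the preceding elements are exactly those of
      \<open>xs\<close>.\<close>
    moreover have "x \<in> \<Psi> (set xs)"
      using snoc.prems(2)[rule_format, of "length xs"] by simp
    ultimately show ?case
      using assms(3) snoc.prems(1) by simp
  qed
  then show ?thesis using xs(1) by simp
qed

lemma antimatroid_generated_family:
  assumes "expansion_operator E \<Psi>" and "isotone_operator E \<Psi>"
  shows "antimatroid E (generated_family E \<Psi>)"
proof -
  have A1: "X \<noteq> {} \<longrightarrow> (\<exists>x\<in>X. X - {x} \<in> generated_family E \<Psi>)"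
    if "X \<in> generated_family E \<Psi>" for X
    using that
  proof (induction rule: generated_family_induct)
    case (insert X x)
    \<comment> \<open>The element to remove is the last one added: it lies outside \<open>X\<close>,
      so its removal gives back the generated set \<open>X\<close>.\<close>
    have "\<Psi> X \<subseteq> E - X"
      using assms(1) generated_family_subset[OF insert.hyps(1)]
      by (simp add: expansion_operator_def)
    then have "insert x X - {x} = X"
      using insert.hyps(2) by auto
    then show ?case using insert.hyps(1) by (metis insertI1)
  qed simp
  have A2: "\<not> X \<subseteq> Y \<longrightarrow> (\<exists>x\<in>X - Y. Y \<union> {x} \<in> generated_family E \<Psi>)"
    if "X \<in> generated_family E \<Psi>" and Y: "Y \<in> generated_family E \<Psi>" for X Y
    using that(1)
  proof (induction rule: generated_family_induct)
    case (insert X x)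
    show ?case
    \<comment> \<open>The condition says that \<open>x\<close> is the first element of the sequence
      outside \<open>Y\<close>. If it fails, either \<open>X\<close> already leaves \<open>Y\<close>
      and the induction hypothesis supplies an element, or \<open>insert x X\<close> is contained in
      \<open>Y\<close>.\<close>
    proof (cases "X \<subseteq> Y \<and> x \<notin> Y")
      case True
      have "\<Psi> X \<inter> (E - Y) \<subseteq> \<Psi> Y"
        using assms(2) True generated_family_subset[OF Y] by (simp add: isotone_operator_def)
      then have "x \<in> \<Psi> Y"
        using True insert.hyps(2,3) by auto
      then have "Y \<union> {x} \<in> generated_family E \<Psi>"
        using generated_family_insert[OF Y] insert.hyps(3) by simp
      then show ?thesis
        using True by blast
    next
      case False
      then show ?thesis using insert.IH by blast
    qed
  qed simp
  show ?thesis
    unfolding antimatroid_def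
  proof (intro conjI ballI)
    show "generated_family E \<Psi> \<subseteq> Pow E"
      by (auto dest: generated_family_subset)
    show "generated_family E \<Psi> \<noteq> {}"
      using generated_family_empty[of E \<Psi>] by auto
  qed (fact A1, fact A2)
qed

text \<open>The operator also needs values at infeasible \<open>X\<close>. Letting \<open>Z\<close>
  range over feasible subsets of \<open>X\<close> makes the condition on \<open>x\<close> monotone
  in \<open>X\<close>, whence isotonicity for an arbitrary family \<open>F\<close>.\<close>

definition extension_operator :: "'a set \<Rightarrow> 'a set set \<Rightarrow> 'a set \<Rightarrow> 'a set" where
  "extension_operator E F X = {x \<in> E - X. \<exists>Z\<in>F. Z \<subseteq> X \<and> insert x Z \<in> F}"

lemma expansion_operator_extension_operator: "expansion_operator E (extension_operator E F)"
  by (auto simp: expansion_operator_def extension_operator_def)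

lemma isotone_operator_extension_operator: "isotone_operator E (extension_operator E F)"
  unfolding isotone_operator_def extension_operator_def by blast

lemma antimatroid_feasible_subset: "antimatroid E F \<Longrightarrow> X \<in> F \<Longrightarrow> X \<subseteq> E"
  by (auto simp: antimatroid_def)

lemma antimatroid_remove:
  "antimatroid E F \<Longrightarrow> X \<in> F \<Longrightarrow> X \<noteq> {} \<Longrightarrow> \<exists>x\<in>X. X - {x} \<in> F"
  by (simp add: antimatroid_def)

lemma antimatroid_augment:
  "antimatroid E F \<Longrightarrow> X \<in> F \<Longrightarrow> Y \<in> F \<Longrightarrow> \<not> X \<subseteq> Y \<Longrightarrow> \<exists>x\<in>X - Y. Y \<union> {x} \<in> F"
  by (simp add: antimatroid_def)

text \<open>Removing elements by (A1) from any feasible set stays in \<open>F\<close> and, by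
  finiteness, ends at the empty set, where every generating sequence starts.\<close>

lemma antimatroid_empty:
  assumes "finite E" and "antimatroid E F"
  shows "{} \<in> F"
proof -
  have "{} \<in> F" if "finite X" "X \<in> F" for X
    using that
  proof (induction rule: finite_psubset_induct)
    case (psubset X)
    show ?case
    proof (cases "X = {}")
      case False
      then obtain x where "x \<in> X" "X - {x} \<in> F"
        using antimatroid_remove[OF assms(2) psubset.prems] by blast
      then show ?thesis using psubset.IH[of "X - {x}"] by blast
    qed (use psubset.prems in simp)
  qed
  moreover obtain X where "X \<in> F"
    using assms(2) by (auto simp: antimatroid_def)
  ultimately show ?thesis
    using finite_subset[OF antimatroid_feasible_subset[OF assms(2)] assms(1)] by simp
qed

lemma antimatroid_eq_generated_family:
  assumes "finite E" and "antimatroid E F"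
  shows "F = generated_family E (extension_operator E F)"
proof (intro subset_antisym subsetI)
  note sub = antimatroid_feasible_subset[OF assms(2)]
  fix X assume "X \<in> F"
  moreover have "finite X"
    using assms(1) sub[OF \<open>X \<in> F\<close>] by (rule rev_finite_subset)
  ultimately show "X \<in> generated_family E (extension_operator E F)"
  \<comment> \<open>The removed element is dictated by (A1) and cannot be chosen freely, so the
    induction is on cardinality rather than on the insertion structure of finite sets.\<close>
  proof (induction X rule: measure_induct_rule[of card])
    case (less X)
    show ?case
    proof (cases "X = {}")
      case False
      then obtain x where x: "x \<in> X" "X - {x} \<in> F"
        using antimatroid_remove[OF assms(2) less.prems(1)] by blast
      have gen: "X - {x} \<in> generated_family E (extension_operator E F)"
        using less.IH[OF card_Diff1_less[OF less.prems(2) x(1)] x(2)] less.prems(2) by simp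
      have X: "insert x (X - {x}) = X" and "x \<in> E"
        using x(1) sub[OF less.prems(1)] by auto
      \<comment> \<open>Being feasible, \<open>X - {x}\<close> serves as its own witness
        \<open>Z\<close>.\<close>
      have "x \<in> extension_operator E F (X - {x})"
        unfolding extension_operator_def
        using x(2) X less.prems(1) \<open>x \<in> E\<close> by (intro CollectI conjI bexI[of _ "X - {x}"]) simp_all
      from generated_family_insert[OF gen this \<open>x \<in> E\<close>] show ?thesis
        unfolding X .
    qed (simp add: generated_family_empty)
  qed
next
  fix X assume "X \<in> generated_family E (extension_operator E F)"
  then show "X \<in> F"
  proof (induction rule: generated_family_induct)
    case empty
    show ?case using assms by (rule antimatroid_empty)
  next
    case (insert X x)
    then obtain Z where Z: "x \<notin> X" "Z \<subseteq> X" "insert x Z \<in> F"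
      by (auto simp: extension_operator_def)
    then have "\<not> insert x Z \<subseteq> X" by blast
    then obtain y where "y \<in> insert x Z - X" "X \<union> {y} \<in> F"
      using antimatroid_augment[OF assms(2) Z(3) insert.IH] by blast
    moreover from this have "y = x" using Z(2) by blast
    ultimately show ?case by simp
  qed
qed

theorem theorem1:
  fixes E :: "'a set" and F :: "'a set set"
  assumes "finite E" and "F \<subseteq> Pow E"
  shows "antimatroid E F \<longleftrightarrow>
    (\<exists>\<Psi>. expansion_operator E \<Psi> \<and> isotone_operator E \<Psi> \<and> F = generated_family E \<Psi>)"
proof
  assume "antimatroid E F"
  then have "F = generated_family E (extension_operator E F)"
    by (rule antimatroid_eq_generated_family[OF assms(1)])
  then show "\<exists>\<Psi>. expansion_operator E \<Psi> \<and> isotone_operator E \<Psi> \<and> F = generated_family E \<Psi>"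
    using expansion_operator_extension_operator isotone_operator_extension_operator
    by (intro exI conjI)
next
  assume "\<exists>\<Psi>. expansion_operator E \<Psi> \<and> isotone_operator E \<Psi> \<and> F = generated_family E \<Psi>"
  then show "antimatroid E F"
    by (elim exE conjE) (simp add: antimatroid_generated_family)
qed

end
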